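(* For every integer $n\ge 0$, $c_6(n)$ is odd if $n=(7j^2+5j)/2$ for some $j\in\mathbb{Z}$, and $c_6(n)$ is even otherwise.
   Context: A partition of $n\ge 0$ is a finite multiset of positive integers summing to $n$; the empty partition is the partition of $0$. For $n\ge 0$, $c_6(n)$ denotes the number of partitions $\lambda$ of $n$ such that either (a) the even parts of $\lambda$ are distinct and $1$ is the only odd integer that may be a part (with any multiplicity), or (b) there is an integer $j\ge 1$ such that each of $2,4,\dots,2j$ appears in $\lambda$ exactly twice, every even part greater than $2j$ is at least $4j+2$ and appears at most once, every odd part is at most $2j+1$, each odd part at most $2j-1$ appears at most once, and the part $2j+1$ may appear with any multiplicity. *)

theory Defs
  imports Main "HOL-Library.Multiset"
begin

definition is_partition :: "nat multiset \<Rightarrow> nat \<Rightarrow> bool" where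
  "is_partition p n \<longleftrightarrow> (\<forall>k\<in>#p. k > 0) \<and> sum_mset p = n"

definition cond_a :: "nat multiset \<Rightarrow> bool" where
  "cond_a p \<longleftrightarrow> (\<forall>k. even k \<longrightarrow> count p k \<le> 1) \<and> (\<forall>k\<in>#p. odd k \<longrightarrow> k = 1)"

definition cond_b :: "nat \<Rightarrow> nat multiset \<Rightarrow> bool" where
  "cond_b j p \<longleftrightarrow>
     (\<forall>i\<in>{1..j}. count p (2*i) = 2) \<and>
     (\<forall>k\<in>#p. even k \<and> k > 2*j \<longrightarrow> k \<ge> 4*j+2 \<and> count p k \<le> 1) \<and>
     (\<forall>k\<in>#p. odd k \<longrightarrow> k \<le> 2*j+1) \<and>
     (\<forall>k. odd k \<and> k + 1 \<le> 2*j \<longrightarrow> count p k \<le> 1)"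

definition c6 :: "nat \<Rightarrow> nat" where
  "c6 n = card {p. is_partition p n \<and> (cond_a p \<or> (\<exists>j\<ge>1. cond_b j p))}"

end

theory Submission
  imports Defs "HOL-Computational_Algebra.Formal_Power_Series"
begin

text \<open>
  Condition (a) is condition (b) with \<open>j = 0\<close>, and the value of \<open>j\<close> is determined by the partition.
  For fixed \<open>j\<close>, trading a part \<open>4j+2\<close> for two parts \<open>2j+1\<close> cancels in pairs all partitions except
  those in which \<open>4j+2\<close> is absent and \<open>2j+1\<close> occurs at most once. Hence, modulo 2, the generating
  function of \<open>c\<^sub>6\<close> is \<open>\<Sum>\<^sub>j q^(2j(j+1)) (q;q^2)\<^sub>j\<^sub>+\<^sub>1 (q^(4j+4);q^2)\<^sub>\<infinity>\<close>, which by the third Rogers-Selberg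
  identity is \<open>\<Sum>\<^sub>j (-1)^j q^((7j^2+5j)/2)\<close>, a series whose exponents are pairwise distinct.

  The Rogers-Selberg identity is proved with Bailey's lemma in base \<open>Q = q^2\<close>: the Bailey pair is the
  finite pentagonal-type identity
  \<open>\<Sum>\<^sub>j (-1)^j q^(j(3j+1)/2) / ((Q)\<^sub>n\<^sub>-\<^sub>j (Q)\<^sub>n\<^sub>+\<^sub>j\<^sub>+\<^sub>1) = (q;q^2)\<^sub>n\<^sub>+\<^sub>1 / (Q)\<^sub>2\<^sub>n\<^sub>+\<^sub>1\<close>, obtained from the \<open>q\<close>-Pascal rule, and
  the summation over \<open>n\<close> is a \<open>q\<close>-Vandermonde sum. Multiplying the finite form of level \<open>l\<close> by
  \<open>(Q)\<^sub>l (Q)\<^sub>2\<^sub>l\<^sub>+\<^sub>1\<close> gives factors \<open>1 - q^m\<close> that do not affect the coefficients up to \<open>q^l\<close>, so no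
  infinite product is needed.
\<close>

section \<open>A Bailey pair\<close>

text \<open>Integer exponents avoid truncated subtraction when \<open>j\<close> is negative. A
  negative exponent gives 1, so the addition law below asks for nonnegative summands.\<close>

definition qpow :: "int \<Rightarrow> int fps" where
  "qpow k = fps_X ^ nat k"

text \<open>The q-factorial \<open>(Q;Q)_n\<close> in base \<open>Q = q^2\<close>.\<close>

definition qpoch :: "nat \<Rightarrow> int fps" where
  "qpoch n = (\<Prod>i=1..n. 1 - fps_X ^ (2 * i))"

text \<open>The value 0 at negative arguments plays the role of \<open>1 / (Q)\<^sub>-\<^sub>k\<close> and makes \<open>(1 - Q^k) / (Q)\<^sub>k = 1 / (Q)\<^sub>k\<^sub>-\<^sub>1\<close> hold at \<open>k = 0\<close>.\<close>

definition rpoch :: "int \<Rightarrow> int fps" where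
  "rpoch k = (if k < 0 then 0 else fps_right_inverse (qpoch (nat k)) 1)"

definition pent_term :: "int \<Rightarrow> int fps" where
  "pent_term j = (if even j then 1 else - 1) * qpow (j * (3 * j + 1) div 2)"

text \<open>These are the denominators of a Bailey pair relative to \<open>a = 1\<close>; those of
  \<open>pent_odd\<close> belong to \<open>a = Q\<close>, up to the constant factor
  \<open>1 - Q\<close>. The evaluation alternates between the two sums.\<close>

definition pent_even :: "nat \<Rightarrow> int fps" where
  "pent_even n = (\<Sum>j = - int n..int n. pent_term j * rpoch (int n - j) * rpoch (int n + j))"

definition pent_odd :: "nat \<Rightarrow> int fps" where
  "pent_odd n = (\<Sum>j = - int n - 1..int n. pent_term j * rpoch (int n - j) * rpoch (int n + j + 1))"

section \<open>Powers, q-factorials and their reciprocals\<close>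

lemma qpow_add: "a \<ge> 0 \<Longrightarrow> b \<ge> 0 \<Longrightarrow> qpow (a + b) = qpow a * qpow b"
  by (simp add: qpow_def nat_add_distrib power_add)

lemma qpow_of_nat: "qpow (int k) = fps_X ^ k"
  by (simp add: qpow_def)

lemma one_minus_qpow_neq_0:
  assumes "k > 0" shows "1 - qpow k \<noteq> 0"
proof
  assume "1 - qpow k = 0"
  hence "fps_nth (1 - qpow k) 0 = 0" by simp
  thus False using assms by (simp add: qpow_def)
qed

lemma qpoch_Suc: "qpoch (Suc n) = qpoch n * (1 - fps_X ^ (2 * Suc n))"
  by (simp add: qpoch_def)

lemma qpoch_nth_0: "fps_nth (qpoch n) 0 = 1"
  by (induction n) (simp_all add: qpoch_def fps_mult_nth)

lemma qpoch_mult_rpoch: "qpoch n * rpoch (int n) = 1"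
  using fps_right_inverse[of "qpoch n" 1] by (simp add: rpoch_def qpoch_nth_0)

lemma rpoch_0 [simp]: "rpoch 0 = 1"
  using qpoch_mult_rpoch[of 0] by (simp add: qpoch_def)

lemma rpoch_neg [simp]: "k < 0 \<Longrightarrow> rpoch k = 0"
  by (simp add: rpoch_def)

lemma rpoch_rec:
  assumes "k \<ge> 0" shows "(1 - qpow (2 * k)) * rpoch k = rpoch (k - 1)"
proof (cases "k = 0")
  case True
  thus ?thesis by (simp add: qpow_def)
next
  case False
  define n where "n = nat (k - 1)"
  have k: "k = int (Suc n)" using False assms by (simp add: n_def)
  have q: "qpow (2 * k) = fps_X ^ (2 * Suc n)"
    unfolding k using qpow_of_nat[of "2 * Suc n"] by simp
  have "rpoch (k - 1) = rpoch (int n) * (qpoch (Suc n) * rpoch (int (Suc n)))"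
    by (simp only: qpoch_mult_rpoch) (simp add: k)
  also have "\<dots> = (qpoch n * rpoch (int n)) * ((1 - qpow (2 * k)) * rpoch k)"
    unfolding q unfolding k by (simp only: qpoch_Suc mult_ac)
  finally show ?thesis by (simp add: qpoch_mult_rpoch)
qed

text \<open>The q-Pascal rule for reciprocals, from
  \<open>1 - Q^(a+b) = (1 - Q^a) + Q^a (1 - Q^b)\<close>. The shifted indices are separate variables
  with equations, so that the rule matches whatever form they take in an application.\<close>

lemma rpoch_pascal:
  assumes "a \<ge> 0" "b \<ge> 0" and c: "c = a + b" and a': "a' = a - 1" and b': "b' = b - 1"
  shows "(1 - qpow (2 * c)) * (rpoch a * rpoch b) =
    rpoch a' * rpoch b + qpow (2 * a) * rpoch a * rpoch b'"
proof -
  have "qpow (2 * c) = qpow (2 * a) * qpow (2 * b)"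
    using assms by (simp add: distrib_left qpow_add)
  thus ?thesis
    unfolding a' b' rpoch_rec[OF assms(1), symmetric] rpoch_rec[OF assms(2), symmetric]
    by (simp add: algebra_simps)
qed

section \<open>Recurrences for the two pentagonal sums\<close>

lemma pent_nonneg: "j * (3 * j + 1) \<ge> (0::int)"
  by (cases "j \<ge> 0") (auto intro: mult_nonpos_nonpos)

lemma pent_div_nonneg: "j * (3 * j + 1) div 2 \<ge> (0::int)"
  using pent_nonneg[of j] by (simp only: pos_imp_zdiv_nonneg_iff)

lemma pent_double: "2 * (j * (3 * j + 1) div 2) = j * (3 * j + 1)" for j :: int
  by simp

text \<open>The q-Pascal rule with indices \<open>n+j+1\<close> and \<open>n-j\<close> splits the
  left side into \<open>pent_even n\<close> and a second sum, which a reflection of \<open>j\<close>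
  turns into \<open>- q^(2n+1)\<close> times \<open>pent_even n\<close>.\<close>

lemma pent_odd_rec:
  "(1 - qpow (2 * (2 * int n + 1))) * pent_odd n = (1 - qpow (2 * int n + 1)) * pent_even n"
proof -
  let ?n = "int n"
  have "(1 - qpow (2 * (2 * ?n + 1))) * pent_odd n =
     (\<Sum>j = - ?n - 1..?n. pent_term j * rpoch (?n - j) * rpoch (?n + j)
        + pent_term j * (qpow (2 * (?n + j + 1)) * rpoch (?n + j + 1) * rpoch (?n - j - 1)))"
    unfolding pent_odd_def sum_distrib_left
  proof (rule sum.cong[OF refl])
    fix j assume "j \<in> {- ?n - 1..?n}"
    hence "?n + j + 1 \<ge> 0" "?n - j \<ge> 0" by auto
    hence "(1 - qpow (2 * (2 * ?n + 1))) * (rpoch (?n + j + 1) * rpoch (?n - j)) =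
      rpoch (?n + j) * rpoch (?n - j) + qpow (2 * (?n + j + 1)) * rpoch (?n + j + 1) * rpoch (?n - j - 1)"
      by (intro rpoch_pascal) auto
    thus "(1 - qpow (2 * (2 * ?n + 1))) * (pent_term j * rpoch (?n - j) * rpoch (?n + j + 1)) =
      pent_term j * rpoch (?n - j) * rpoch (?n + j)
        + pent_term j * (qpow (2 * (?n + j + 1)) * rpoch (?n + j + 1) * rpoch (?n - j - 1))"
      by (metis (no_types, lifting) distrib_left mult.assoc mult.commute mult.left_commute)
  qed
  also have "\<dots> = (\<Sum>j = - ?n - 1..?n. pent_term j * rpoch (?n - j) * rpoch (?n + j))
     + (\<Sum>j = - ?n - 1..?n. pent_term j * (qpow (2 * (?n + j + 1)) * rpoch (?n + j + 1) * rpoch (?n - j - 1)))"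
    by (rule sum.distrib)
  \<comment> \<open>The boundary term \<open>j = -n-1\<close> contains
    \<open>rpoch (-1) = 0\<close>; in the second sum the same happens at
    \<open>j = n\<close>.\<close>
  also have "(\<Sum>j = - ?n - 1..?n. pent_term j * rpoch (?n - j) * rpoch (?n + j)) = pent_even n"
    unfolding pent_even_def by (rule sum.mono_neutral_right) auto
  also have "(\<Sum>j = - ?n - 1..?n. pent_term j * (qpow (2 * (?n + j + 1)) * rpoch (?n + j + 1) * rpoch (?n - j - 1)))
     = (\<Sum>j = - ?n - 1..?n - 1. pent_term j * (qpow (2 * (?n + j + 1)) * rpoch (?n + j + 1) * rpoch (?n - j - 1)))"
    by (rule sum.mono_neutral_right) auto
  \<comment> \<open>Reflect by \<open>i = -j-1\<close>: the sign flips because \<open>i\<close> and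
    \<open>j\<close> differ in parity, the two reciprocals swap roles, and the pentagonal exponents
    satisfy equation \<open>e\<close>.\<close>
  also have "\<dots> = (\<Sum>j = - ?n..?n. - qpow (2 * ?n + 1) * (pent_term j * rpoch (?n - j) * rpoch (?n + j)))"
  proof (rule sum.reindex_bij_witness[of _ "\<lambda>j. - j - 1" "\<lambda>j. - j - 1"], goal_cases)
    case (5 j)
    let ?i = "- j - 1"
    have e: "j * (3 * j + 1) div 2 + 2 * (?n + j + 1) = 2 * ?n + 1 + ?i * (3 * ?i + 1) div 2"
      using pent_double[of j] pent_double[of ?i] by (simp add: algebra_simps)
    have "qpow (j * (3 * j + 1) div 2) * qpow (2 * (?n + j + 1))
        = qpow (j * (3 * j + 1) div 2 + 2 * (?n + j + 1))"
      using 5 by (intro qpow_add[symmetric] pent_div_nonneg) auto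
    also have "\<dots> = qpow (2 * ?n + 1) * qpow (?i * (3 * ?i + 1) div 2)"
      unfolding e by (intro qpow_add pent_div_nonneg) auto
    finally have f: "qpow (j * (3 * j + 1) div 2) * qpow (2 * (?n + j + 1)) = \<dots>" .
    have "pent_term j * qpow (2 * (?n + j + 1)) = - qpow (2 * ?n + 1) * pent_term ?i"
      unfolding pent_term_def mult.assoc f by (auto simp del: minus_mult_right)
    moreover have "?n - ?i = ?n + j + 1" "?n + ?i = ?n - j - 1" by auto
    ultimately show ?case by (simp only: mult.assoc[symmetric])
  qed auto
  also have "\<dots> = - qpow (2 * ?n + 1) * pent_even n"
    unfolding pent_even_def sum_distrib_left ..
  finally show ?thesis by (simp add: algebra_simps)
qed

lemma fps_eq_0_of_eq_uminus:
  fixes f :: "int fps"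
  assumes "f = - f" shows "f = 0"
proof (rule fps_ext)
  fix k
  have "fps_nth f k = fps_nth (- f) k" using assms by simp
  thus "fps_nth f k = fps_nth 0 k" by simp
qed

text \<open>The q-Pascal rule with indices \<open>n+1-j\<close> and \<open>n+1+j\<close> produces
  \<open>pent_odd n\<close> and a remainder \<open>?f\<close> whose sum cancels.\<close>

lemma pent_even_rec:
  "(1 - qpow (2 * (2 * int n + 2))) * pent_even (Suc n) = pent_odd n"
proof -
  let ?n = "int n"
  let ?f = "\<lambda>j. pent_term j * (qpow (2 * (?n + 1 - j)) * rpoch (?n + 1 - j) * rpoch (?n + j))"
  have "(1 - qpow (2 * (2 * ?n + 2))) * pent_even (Suc n) =
     (\<Sum>j = - ?n - 1..?n + 1. pent_term j * rpoch (?n - j) * rpoch (?n + j + 1) + ?f j)"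
    unfolding pent_even_def sum_distrib_left
  proof (rule sum.cong)
    fix j assume "j \<in> {- ?n - 1..?n + 1}"
    hence "?n + 1 - j \<ge> 0" "?n + j + 1 \<ge> 0" by auto
    hence "(1 - qpow (2 * (2 * ?n + 2))) * (rpoch (?n + 1 - j) * rpoch (?n + j + 1)) =
      rpoch (?n - j) * rpoch (?n + j + 1) + qpow (2 * (?n + 1 - j)) * rpoch (?n + 1 - j) * rpoch (?n + j)"
      by (intro rpoch_pascal) auto
    moreover have "int (Suc n) - j = ?n + 1 - j" "int (Suc n) + j = ?n + j + 1" by auto
    ultimately show "(1 - qpow (2 * (2 * ?n + 2))) * (pent_term j * rpoch (int (Suc n) - j) * rpoch (int (Suc n) + j)) =
      pent_term j * rpoch (?n - j) * rpoch (?n + j + 1) + ?f j"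
      by (metis (no_types, lifting) distrib_left mult.assoc mult.commute mult.left_commute)
  qed auto
  also have "\<dots> = (\<Sum>j = - ?n - 1..?n + 1. pent_term j * rpoch (?n - j) * rpoch (?n + j + 1))
      + (\<Sum>j = - ?n - 1..?n + 1. ?f j)"
    by (rule sum.distrib)
  also have "(\<Sum>j = - ?n - 1..?n + 1. pent_term j * rpoch (?n - j) * rpoch (?n + j + 1)) = pent_odd n"
    unfolding pent_odd_def by (rule sum.mono_neutral_right) auto
  also have "(\<Sum>j = - ?n - 1..?n + 1. ?f j) = (\<Sum>j = - ?n..?n + 1. ?f j)"
    by (rule sum.mono_neutral_right) auto
  also have "(\<Sum>j = - ?n..?n + 1. ?f j) = 0"
  proof - \<comment> \<open>the sum is antisymmetric under \<open>j \<mapsto> 1 - j\<close>\<close>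
    have "(\<Sum>j = - ?n..?n + 1. ?f j) = (\<Sum>j = - ?n..?n + 1. - ?f j)"
    proof (rule sum.reindex_bij_witness[of _ "\<lambda>j. 1 - j" "\<lambda>j. 1 - j"], goal_cases)
      case (5 j)
      let ?i = "1 - j"
      have e: "j * (3 * j + 1) div 2 + 2 * (?n + 1 - j) = ?i * (3 * ?i + 1) div 2 + 2 * (?n + 1 - ?i)"
        using pent_double[of j] pent_double[of ?i] by (simp add: algebra_simps)
      have "qpow (j * (3 * j + 1) div 2) * qpow (2 * (?n + 1 - j))
          = qpow (j * (3 * j + 1) div 2 + 2 * (?n + 1 - j))"
        using 5 by (intro qpow_add[symmetric] pent_div_nonneg) auto
      also have "\<dots> = qpow (?i * (3 * ?i + 1) div 2) * qpow (2 * (?n + 1 - ?i))"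
        unfolding e using 5 by (intro qpow_add pent_div_nonneg) auto
      finally have f: "qpow (j * (3 * j + 1) div 2) * qpow (2 * (?n + 1 - j)) = \<dots>" .
      have "pent_term j * qpow (2 * (?n + 1 - j)) = - (pent_term ?i * qpow (2 * (?n + 1 - ?i)))"
        unfolding pent_term_def mult.assoc f by auto
      moreover have i: "?n + 1 - ?i = ?n + j" "?n + ?i = ?n + 1 - j" by auto
      ultimately have "pent_term j * qpow (2 * (?n + 1 - j)) * (rpoch (?n + 1 - j) * rpoch (?n + j)) =
          - (pent_term ?i * qpow (2 * (?n + 1 - ?i)) * (rpoch (?n + j) * rpoch (?n + 1 - j)))"
        by (simp only: mult_minus_left mult.commute[of "rpoch (?n + 1 - j)"])
      thus ?case unfolding i by (simp only: mult.assoc)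
    qed auto
    also have "\<dots> = - (\<Sum>j = - ?n..?n + 1. ?f j)" by (rule sum_negf)
    finally show ?thesis by (rule fps_eq_0_of_eq_uminus)
  qed
  finally show ?thesis by simp
qed

text \<open>The two recurrences are climbed alternately, from \<open>pent_even n\<close> to
  \<open>pent_odd n\<close> to \<open>pent_even (Suc n)\<close>, so both evaluations go through one
  induction. Only the passage from even to odd adds a factor \<open>1 - q^(2n+1)\<close> to the
  right side.\<close>

lemma pent_even_odd_eq:
  "qpoch (2 * n) * pent_even n = (\<Prod>i<n. 1 - fps_X ^ (2 * i + 1)) \<and>
   qpoch (2 * n + 1) * pent_odd n = (\<Prod>i<Suc n. 1 - fps_X ^ (2 * i + 1))"
proof (induction n)
  case 0
  have "pent_even 0 = 1" by (simp add: pent_even_def pent_term_def qpow_def)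
  moreover have "qpow 2 = fps_X ^ 2" "qpow 1 = fps_X ^ 1" by (simp_all add: qpow_def)
  ultimately show ?case using pent_odd_rec[of 0] by (simp add: qpoch_def)
next
  case (Suc n)
  have q: "qpow (2 * (2 * int n + 2)) = fps_X ^ (2 * Suc (2 * n + 1))"
      "qpow (2 * (2 * int (Suc n) + 1)) = fps_X ^ (2 * Suc (2 * Suc n))"
      "qpow (2 * int (Suc n) + 1) = fps_X ^ (2 * Suc n + 1)"
    by (simp_all only: flip: qpow_of_nat) (simp_all add: algebra_simps)
  have "qpoch (2 * Suc n) * pent_even (Suc n) = qpoch (2 * n + 1) * pent_odd n"
    using pent_even_rec[of n] unfolding q
    using qpoch_Suc[of "2 * n + 1"] by (simp add: mult.assoc)
  with Suc have 1: "qpoch (2 * Suc n) * pent_even (Suc n) = (\<Prod>i<Suc n. 1 - fps_X ^ (2 * i + 1))"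
    by simp
  have "qpoch (2 * Suc n + 1) * pent_odd (Suc n) =
      qpoch (2 * Suc n) * ((1 - fps_X ^ (2 * Suc (2 * Suc n))) * pent_odd (Suc n))"
    using qpoch_Suc[of "2 * Suc n"] by (simp add: mult.assoc)
  also have "\<dots> = (1 - fps_X ^ (2 * Suc n + 1)) * (qpoch (2 * Suc n) * pent_even (Suc n))"
    using pent_odd_rec[of "Suc n"] unfolding q by (simp only: mult_ac)
  also have "\<dots> = (\<Prod>i<Suc (Suc n). 1 - fps_X ^ (2 * i + 1))"
    unfolding 1 by (simp add: mult.commute)
  finally show ?case using 1 by blast
qed

section \<open>The Rogers-Selberg identity\<close>

text \<open>Induction on \<open>a\<close> with \<open>k\<close> free: after multiplication by
  \<open>1 - Q^(a+1)\<close>, the q-Pascal rule expresses level \<open>a+1\<close> at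
  \<open>k\<close> through level \<open>a\<close> at \<open>k\<close> and
  \<open>k+1\<close>.\<close>

lemma rpoch_vandermonde:
  "(\<Sum>m\<le>a. qpow (2 * (int m * (int m + int k))) * rpoch (int m) * rpoch (int a - int m) * rpoch (int m + int k))
    = rpoch (int a) * rpoch (int a + int k)"
proof (induction a arbitrary: k)
  case 0
  show ?case by (simp add: qpow_def)
next
  case (Suc a)
  let ?V = "\<lambda>a k. \<Sum>m\<le>a. qpow (2 * (int m * (int m + int k))) * rpoch (int m) * rpoch (int a - int m) * rpoch (int m + int k)"
  let ?A = "int (Suc a)"
  let ?g = "\<lambda>m. qpow (2 * (int m * (int m + int k))) * rpoch (int m + int k) * (qpow (2 * (?A - int m)) * rpoch (?A - int m) * rpoch (int m - 1))"
  have "(1 - qpow (2 * ?A)) * ?V (Suc a) k =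
    (\<Sum>m\<le>Suc a. qpow (2 * (int m * (int m + int k))) * rpoch (int m) * rpoch (int a - int m) * rpoch (int m + int k) + ?g m)"
    unfolding sum_distrib_left
  proof (rule sum.cong[OF refl])
    fix m assume "m \<in> {..Suc a}"
    hence "?A - int m \<ge> 0" "int m \<ge> 0" by auto
    hence *: "(1 - qpow (2 * ?A)) * (rpoch (?A - int m) * rpoch (int m)) =
       rpoch (int a - int m) * rpoch (int m) + qpow (2 * (?A - int m)) * rpoch (?A - int m) * rpoch (int m - 1)"
      by (intro rpoch_pascal) auto
    have "(1 - qpow (2 * ?A)) * (qpow (2 * (int m * (int m + int k))) * rpoch (int m) * rpoch (?A - int m) * rpoch (int m + int k))
      = qpow (2 * (int m * (int m + int k))) * rpoch (int m + int k) * ((1 - qpow (2 * ?A)) * (rpoch (?A - int m) * rpoch (int m)))"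
      by (simp only: mult_ac)
    also have "\<dots> = qpow (2 * (int m * (int m + int k))) * rpoch (int m) * rpoch (int a - int m) * rpoch (int m + int k) + ?g m"
      unfolding * by (simp only: distrib_left mult_ac)
    finally show "(1 - qpow (2 * ?A)) * (qpow (2 * (int m * (int m + int k))) * rpoch (int m) * rpoch (?A - int m) * rpoch (int m + int k)) = \<dots>" .
  qed
  also have "\<dots> = (\<Sum>m\<le>Suc a. qpow (2 * (int m * (int m + int k))) * rpoch (int m) * rpoch (int a - int m) * rpoch (int m + int k)) + sum ?g {..Suc a}"
    by (rule sum.distrib)
  also have "(\<Sum>m\<le>Suc a. qpow (2 * (int m * (int m + int k))) * rpoch (int m) * rpoch (int a - int m) * rpoch (int m + int k)) = ?V a k"
    by simp
  \<comment> \<open>The term \<open>m = 0\<close> contains \<open>rpoch (-1) = 0\<close>, so the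
    index can be shifted.\<close>
  also have "sum ?g {..Suc a} = (\<Sum>m\<le>a. ?g (Suc m))"
    by (subst sum.atMost_Suc_shift) simp
  also have "\<dots> = qpow (2 * (?A + int k)) * ?V a (Suc k)"
    unfolding sum_distrib_left
  proof (rule sum.cong[OF refl])
    fix m assume m: "m \<in> {..a}"
    let ?m = "int (Suc m)"
    have "qpow (2 * (?m * (?m + int k))) * qpow (2 * (?A - ?m)) = qpow (2 * (?m * (?m + int k)) + 2 * (?A - ?m))"
      using m by (intro qpow_add[symmetric]) auto
    also have "2 * (?m * (?m + int k)) + 2 * (?A - ?m) = 2 * (?A + int k) + 2 * (int m * (int m + int (Suc k)))"
      by (simp add: algebra_simps)
    also have "qpow \<dots> = qpow (2 * (?A + int k)) * qpow (2 * (int m * (int m + int (Suc k))))"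
      by (intro qpow_add) auto
    finally have e: "qpow (2 * (?m * (?m + int k))) * qpow (2 * (?A - ?m)) = \<dots>" .
    have "?g (Suc m) = (qpow (2 * (?m * (?m + int k))) * qpow (2 * (?A - ?m))) * rpoch (int m) * rpoch (int a - int m) * rpoch (int m + int (Suc k))"
      by (simp add: mult_ac add_ac)
    also have "\<dots> = qpow (2 * (?A + int k)) * (qpow (2 * (int m * (int m + int (Suc k)))) * rpoch (int m) * rpoch (int a - int m) * rpoch (int m + int (Suc k)))"
      unfolding e by (simp only: mult_ac)
    finally show "?g (Suc m) = \<dots>" .
  qed
  also have "?V a k + qpow (2 * (?A + int k)) * ?V a (Suc k) =
      rpoch (int a) * (rpoch (int a + int k) + qpow (2 * (?A + int k)) * rpoch (?A + int k))"
    unfolding Suc.IH by (simp add: algebra_simps)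
  \<comment> \<open>With this rewriting the bracket collapses to \<open>rpoch (?A + int k)\<close>,
    and the nonzero factor \<open>1 - Q^(a+1)\<close> can be cancelled.\<close>
  also have "rpoch (int a + int k) = (1 - qpow (2 * (?A + int k))) * rpoch (?A + int k)"
    using rpoch_rec[of "?A + int k"] by simp
  also have "rpoch (int a) = (1 - qpow (2 * ?A)) * rpoch ?A"
    using rpoch_rec[of ?A] by simp
  also have "(1 - qpow (2 * ?A)) * rpoch ?A * ((1 - qpow (2 * (?A + int k))) * rpoch (?A + int k) + qpow (2 * (?A + int k)) * rpoch (?A + int k))
     = (1 - qpow (2 * ?A)) * (rpoch ?A * rpoch (?A + int k))"
    by (simp add: algebra_simps)
  finally show ?case using one_minus_qpow_neq_0[of "2 * ?A"] by simp
qed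

text \<open>This is the inner sum of Bailey's lemma for a fixed \<open>j\<close>. Both sides are
  invariant under the reflection of \<open>j\<close> to \<open>-j-1\<close>, which reduces the claim
  to a natural number \<open>r\<close>.\<close>

lemma rpoch_vandermonde_int:
  assumes "j \<in> {- int l - 1..int l}"
  shows "(\<Sum>n\<le>l. qpow (2 * (int n * (int n + 1))) * rpoch (int l - int n)
            * (rpoch (int n - j) * rpoch (int n + j + 1)))
    = qpow (2 * (j * (j + 1))) * (rpoch (int l - j) * rpoch (int l + j + 1))"
proof -
  have nonneg: "(\<Sum>n\<le>l. qpow (2 * (int n * (int n + 1))) * rpoch (int l - int n)
            * (rpoch (int n - int r) * rpoch (int n + int r + 1)))
    = qpow (2 * (int r * (int r + 1))) * (rpoch (int l - int r) * rpoch (int l + int r + 1))"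
    (is "sum ?f _ = _") if "r \<le> l" for r
  proof -
    have "sum ?f {..l} = sum ?f {r..l}"
      by (rule sum.mono_neutral_right) auto
    \<comment> \<open>Put \<open>n = m + r\<close> and use
      \<open>n(n+1) = r(r+1) + m(m+2r+1)\<close>; the remaining sum is q-Vandermonde with
      \<open>k = 2r+1\<close>.\<close>
    also have "\<dots> = (\<Sum>m\<le>l - r. qpow (2 * (int r * (int r + 1))) *
        (qpow (2 * (int m * (int m + int (2 * r + 1)))) * rpoch (int m) * rpoch (int (l - r) - int m)
          * rpoch (int m + int (2 * r + 1))))"
    proof (rule sum.reindex_bij_witness[of _ "\<lambda>m. m + r" "\<lambda>n. n - r"], goal_cases)
      case (5 n)
      define m where "m = n - r"
      have n: "n = m + r" using 5 by (simp add: m_def)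
      have "qpow (2 * (int r * (int r + 1))) * qpow (2 * (int m * (int m + int (2 * r + 1))))
          = qpow (2 * (int r * (int r + 1)) + 2 * (int m * (int m + int (2 * r + 1))))"
        by (intro qpow_add[symmetric]) auto
      also have "\<dots> = qpow (2 * (int n * (int n + 1)))"
        by (rule arg_cong[of _ _ qpow]) (simp add: n algebra_simps)
      finally have e: "qpow (2 * (int n * (int n + 1))) =
          qpow (2 * (int r * (int r + 1))) * qpow (2 * (int m * (int m + int (2 * r + 1))))" ..
      have a: "int (l - r) - int m = int l - int n" "int m + int (2 * r + 1) = int n + int r + 1"
          "int m = int n - int r"
        using that by (auto simp: n)
      show ?case unfolding e m_def[symmetric] a(1,2) unfolding a(3) by (simp only: mult_ac)
    qed (use that in auto)
    also have "\<dots> = qpow (2 * (int r * (int r + 1))) * (rpoch (int (l - r)) * rpoch (int (l - r) + int (2 * r + 1)))"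
      by (simp only: sum_distrib_left[symmetric] rpoch_vandermonde)
    also have "int (l - r) = int l - int r" using that by auto
    finally show ?thesis by (simp add: algebra_simps)
  qed
  show ?thesis
  proof (cases "j \<ge> 0")
    case True
    with nonneg[of "nat j"] assms show ?thesis by simp
  next
    case False
    define r where "r = nat (- j - 1)"
    have j: "j = - int r - 1" using False by (simp add: r_def)
    have "r \<le> l" using assms by (simp add: j)
    have eq: "int n - j = int n + int r + 1" "int n + j + 1 = int n - int r"
      "j * (j + 1) = int r * (int r + 1)" for n
      by (auto simp: j algebra_simps)
    show ?thesis using nonneg[OF \<open>r \<le> l\<close>] unfolding eq by (simp only: mult_ac)
  qed
qed

text \<open>Finite Bailey lemma for \<open>a = Q\<close> with both parameters sent to infinity:
  interchange the sums and evaluate the inner one by q-Vandermonde.\<close>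

lemma bailey_sum:
  "(\<Sum>n\<le>l. qpow (2 * (int n * (int n + 1))) * rpoch (int l - int n) * pent_odd n) =
   (\<Sum>j = - int l - 1..int l. pent_term j * (qpow (2 * (j * (j + 1))) * (rpoch (int l - j) * rpoch (int l + j + 1))))"
proof -
  have "(\<Sum>n\<le>l. qpow (2 * (int n * (int n + 1))) * rpoch (int l - int n) * pent_odd n) =
    (\<Sum>n\<le>l. \<Sum>j = - int l - 1..int l. pent_term j * (qpow (2 * (int n * (int n + 1))) * rpoch (int l - int n)
            * (rpoch (int n - j) * rpoch (int n + j + 1))))"
  proof (rule sum.cong[OF refl])
    fix n assume n: "n \<in> {..l}"
    \<comment> \<open>A range of \<open>j\<close> independent of \<open>n\<close> permits the
      interchange; each added term has a reciprocal with negative index.\<close>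
    have "pent_odd n = (\<Sum>j = - int l - 1..int l. pent_term j * rpoch (int n - j) * rpoch (int n + j + 1))"
      unfolding pent_odd_def using n by (intro sum.mono_neutral_left) auto
    thus "qpow (2 * (int n * (int n + 1))) * rpoch (int l - int n) * pent_odd n =
      (\<Sum>j = - int l - 1..int l. pent_term j * (qpow (2 * (int n * (int n + 1))) * rpoch (int l - int n)
            * (rpoch (int n - j) * rpoch (int n + j + 1))))"
      by (simp only: sum_distrib_left mult_ac)
  qed
  also have "\<dots> = (\<Sum>j = - int l - 1..int l. pent_term j * (\<Sum>n\<le>l. qpow (2 * (int n * (int n + 1))) * rpoch (int l - int n)
            * (rpoch (int n - j) * rpoch (int n + j + 1))))"
    by (subst sum.swap) (simp only: sum_distrib_left)
  also have "\<dots> = (\<Sum>j = - int l - 1..int l. pent_term j * (qpow (2 * (j * (j + 1))) * (rpoch (int l - j) * rpoch (int l + j + 1))))"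
    by (intro sum.cong refl) (simp only: rpoch_vandermonde_int)
  finally show ?thesis .
qed

section \<open>Congruences modulo powers of q and the truncated identity\<close>

lemma qpoch_split:
  assumes "m \<le> n"
  shows "qpoch n = qpoch m * (\<Prod>i=Suc m..n. 1 - fps_X ^ (2 * i))"
  using assms
proof (induction n rule: dec_induct)
  case (step n)
  thus ?case by (simp only: qpoch_Suc) (simp add: mult.assoc)
qed simp

lemma qpoch_rpoch:
  assumes "m \<le> n"
  shows "qpoch n * rpoch (int m) = (\<Prod>i=Suc m..n. 1 - fps_X ^ (2 * i))"
proof -
  have "qpoch n * rpoch (int m) = (qpoch m * rpoch (int m)) * (\<Prod>i=Suc m..n. 1 - fps_X ^ (2 * i))"
    unfolding qpoch_split[OF assms] by (simp only: mult_ac)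
  thus ?thesis by (simp add: qpoch_mult_rpoch)
qed

text \<open>Modulo \<open>X^n\<close>, a factor \<open>1 - X^(c i)\<close> acts as 1 on multiples of
  \<open>X^m\<close> once \<open>m + c i\<close> reaches \<open>n\<close>; factors are removed one
  at a time.\<close>

lemma fps_X_power_dvd_prod_diff:
  fixes f :: "int fps"
  assumes "finite I" "\<And>i. i \<in> I \<Longrightarrow> n \<le> m + c i"
  shows "fps_X ^ n dvd fps_X ^ m * f * (\<Prod>i\<in>I. 1 - fps_X ^ c i) - fps_X ^ m * f"
  using assms
proof (induction I rule: finite_induct)
  case (insert x I)
  let ?P = "\<Prod>i\<in>I. 1 - fps_X ^ c i :: int fps"
  have "fps_X ^ m * f * (\<Prod>i\<in>insert x I. 1 - fps_X ^ c i) - fps_X ^ m * f =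
    (fps_X ^ m * f * ?P - fps_X ^ m * f) - fps_X ^ (m + c x) * (f * ?P)"
    using insert.hyps by (simp add: algebra_simps power_add)
  moreover have "fps_X ^ n dvd fps_X ^ m * f * ?P - fps_X ^ m * f"
    using insert by simp
  moreover have "fps_X ^ n dvd fps_X ^ (m + c x) * (f * ?P)"
    using insert.prems by (intro dvd_mult2 le_imp_power_dvd) auto
  ultimately show ?case by (simp only: dvd_diff)
qed simp

lemma fps_nth_eq_of_dvd_diff:
  fixes f g :: "int fps"
  assumes "fps_X ^ n dvd f - g" "k < n"
  shows "fps_nth f k = fps_nth g k"
proof -
  obtain h where h: "f - g = fps_X ^ n * h" using assms(1) by (elim dvdE)
  have "fps_nth (f - g) k = 0" unfolding h using assms(2) by (simp add: fps_X_power_mult_nth)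
  thus ?thesis by simp
qed

text \<open>The quotients are products of \<open>1 - q^(2i)\<close> with \<open>i > l-r\<close> and
  \<open>i > l+r+1\<close>. The prefactor \<open>q^m\<close> makes up for the smaller indices:
  \<open>m + 2(l-r+1) > l\<close> because \<open>r \<le> m\<close> and
  \<open>r \<le> l\<close>.\<close>

lemma dvd_of_qpoch_rpoch:
  assumes "r \<le> l" "r \<le> m"
  shows "fps_X ^ Suc l dvd
    fps_X ^ m * ((qpoch l * rpoch (int l - int r)) * (qpoch (2 * l + 1) * rpoch (int l + int r + 1)))
      - fps_X ^ m"
proof -
  let ?P = "\<Prod>i=Suc (l - r)..l. 1 - fps_X ^ (2 * i) :: int fps"
  let ?R = "\<Prod>i=Suc (l + r + 1)..2 * l + 1. 1 - fps_X ^ (2 * i) :: int fps"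
  have P: "qpoch l * rpoch (int l - int r) = ?P"
    using qpoch_rpoch[of "l - r" l] assms by (simp add: of_nat_diff)
  have R: "qpoch (2 * l + 1) * rpoch (int l + int r + 1) = ?R"
    using qpoch_rpoch[of "l + r + 1" "2 * l + 1"] assms by (simp add: add_ac)
  have "fps_X ^ Suc l dvd fps_X ^ m * ?P * ?R - fps_X ^ m * ?P"
    using assms by (intro fps_X_power_dvd_prod_diff) auto
  moreover have "fps_X ^ Suc l dvd fps_X ^ m * 1 * ?P - fps_X ^ m * 1"
    using assms by (intro fps_X_power_dvd_prod_diff) auto
  ultimately have "fps_X ^ Suc l dvd (fps_X ^ m * ?P * ?R - fps_X ^ m * ?P) + (fps_X ^ m * 1 * ?P - fps_X ^ m * 1)"
    by (rule dvd_add)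
  thus ?thesis unfolding P R by (simp add: mult.assoc)
qed

lemma rogers_selberg_truncated:
  "fps_nth (\<Sum>n\<le>l. fps_X ^ (2 * n * (n + 1)) * (\<Prod>i<Suc n. 1 - fps_X ^ (2 * i + 1))
       * (\<Prod>i=2 * n + 2..2 * l + 1. 1 - fps_X ^ (2 * i)) :: int fps) l =
   (\<Sum>j = - int l - 1..int l. if 2 * int l = 7 * j^2 + 5 * j then if even j then 1 else - 1 else 0)"
proof -
  let ?odd = "\<lambda>n. \<Prod>i<Suc n. 1 - fps_X ^ (2 * i + 1) :: int fps"
  let ?even = "\<lambda>n. \<Prod>i=2 * n + 2..2 * l + 1. 1 - fps_X ^ (2 * i) :: int fps"
  let ?c = "qpoch l * qpoch (2 * l + 1)"
  \<comment> \<open>The pentagonal exponent plus the Bailey weight \<open>2j(j+1)\<close>, which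
    together make \<open>(7j^2+5j)/2\<close>.\<close>
  define e where "e j = j * (3 * j + 1) div 2 + 2 * (j * (j + 1))" for j :: int
  have e2: "2 * e j = 7 * j^2 + 5 * j" for j
    using pent_double[of j] by (simp add: e_def algebra_simps power2_eq_square)
  have jj: "j * (j + 1) \<ge> 0" for j :: int
    by (cases "j \<ge> 0") (auto intro: mult_nonpos_nonpos)
  have e0: "e j \<ge> 0" for j
    using jj[of j] pent_nonneg[of j] by (simp add: e_def)
  let ?t = "\<lambda>j::int. (if even j then 1 else - 1) * fps_X ^ nat (e j) :: int fps"
  \<comment> \<open>The factor \<open>(Q)_(2l+1)\<close> turns \<open>pent_odd n\<close> into the
    two products; the leftover \<open>(Q)_l / (Q)_(l-n)\<close> acts as 1 up to \<open>q^l\<close>,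
    since \<open>2n(n+1) + 2(l-n+1) > l\<close>.\<close>
  have left: "fps_X ^ Suc l dvd (\<Sum>n\<le>l. ?c * (qpow (2 * (int n * (int n + 1))) * rpoch (int l - int n) * pent_odd n))
      - (\<Sum>n\<le>l. fps_X ^ (2 * n * (n + 1)) * ?odd n * ?even n)"
    unfolding sum_subtractf[symmetric]
  proof (rule dvd_sum)
    fix n assume "n \<in> {..l}"
    hence n: "n \<le> l" by simp
    let ?P = "\<Prod>i=Suc (l - n)..l. 1 - fps_X ^ (2 * i) :: int fps"
    have q: "qpow (2 * (int n * (int n + 1))) = fps_X ^ (2 * n * (n + 1))"
      by (simp only: flip: qpow_of_nat) (simp add: algebra_simps)
    have P: "qpoch l * rpoch (int l - int n) = ?P"
      using qpoch_rpoch[of "l - n" l] n by (simp add: of_nat_diff)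
    have "qpoch (2 * l + 1) * pent_odd n = ?even n * (qpoch (2 * n + 1) * pent_odd n)"
      using qpoch_split[of "2 * n + 1" "2 * l + 1"] n by (simp add: mult_ac)
    hence R: "qpoch (2 * l + 1) * pent_odd n = ?odd n * ?even n"
      unfolding pent_even_odd_eq[THEN conjunct2] by (simp only: mult.commute)
    have "?c * (qpow (2 * (int n * (int n + 1))) * rpoch (int l - int n) * pent_odd n) =
       fps_X ^ (2 * n * (n + 1)) * (qpoch (2 * l + 1) * pent_odd n) * (qpoch l * rpoch (int l - int n))"
      unfolding q by (simp only: mult_ac)
    also have "\<dots> = fps_X ^ (2 * n * (n + 1)) * (?odd n * ?even n) * ?P"
      unfolding P R ..
    finally have eq: "?c * (qpow (2 * (int n * (int n + 1))) * rpoch (int l - int n) * pent_odd n) = \<dots>" .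
    have "fps_X ^ Suc l dvd fps_X ^ (2 * n * (n + 1)) * (?odd n * ?even n) * ?P
        - fps_X ^ (2 * n * (n + 1)) * (?odd n * ?even n)"
      using n by (intro fps_X_power_dvd_prod_diff) (auto simp: algebra_simps)
    thus "fps_X ^ Suc l dvd ?c * (qpow (2 * (int n * (int n + 1))) * rpoch (int l - int n) * pent_odd n)
       - fps_X ^ (2 * n * (n + 1)) * ?odd n * ?even n"
      unfolding eq by (simp only: mult.assoc)
  qed
  have right: "fps_X ^ Suc l dvd
     (\<Sum>j = - int l - 1..int l. ?c * (pent_term j * (qpow (2 * (j * (j + 1))) * (rpoch (int l - j) * rpoch (int l + j + 1)))))
      - (\<Sum>j = - int l - 1..int l. ?t j)"
    unfolding sum_subtractf[symmetric]
  proof (rule dvd_sum)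
    fix j assume j: "j \<in> {- int l - 1..int l}"
    have q: "pent_term j * qpow (2 * (j * (j + 1))) = ?t j"
    proof -
      have "qpow (j * (3 * j + 1) div 2) * qpow (2 * (j * (j + 1))) = qpow (e j)"
        unfolding e_def using jj[of j] pent_nonneg[of j] by (intro qpow_add[symmetric]) auto
      thus ?thesis by (simp add: pent_term_def qpow_def mult.assoc)
    qed
    \<comment> \<open>The nonnegative member of the pair \<open>j\<close>, \<open>-j-1\<close>. It
      determines both reciprocals and satisfies \<open>r \<le> r(r+1) = j(j+1) \<le> e j\<close>, as
      the congruence requires.\<close>
    define r where "r = nat (if j \<ge> 0 then j else - j - 1)"
    have r: "r \<le> l" using j by (auto simp: r_def)
    have rj: "int r * (int r + 1) = j * (j + 1)"
      by (auto simp: r_def algebra_simps)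
    have "int r \<le> int r * (int r + 1)" by (simp add: algebra_simps)
    hence "int r \<le> e j"
      unfolding e_def using pent_nonneg[of j] rj by linarith
    hence re: "r \<le> nat (e j)" by simp
    have rr: "rpoch (int l - j) * rpoch (int l + j + 1) = rpoch (int l - int r) * rpoch (int l + int r + 1)"
      by (auto simp: r_def algebra_simps)
    have "?c * (pent_term j * (qpow (2 * (j * (j + 1))) * (rpoch (int l - j) * rpoch (int l + j + 1)))) - ?t j =
      (if even j then 1 else - 1) * (fps_X ^ nat (e j) * ((qpoch l * rpoch (int l - int r)) * (qpoch (2 * l + 1) * rpoch (int l + int r + 1)))
      - fps_X ^ nat (e j))"
      unfolding rr mult.assoc[of "pent_term j", symmetric] q by (simp only: right_diff_distrib mult_ac)
    thus "fps_X ^ Suc l dvd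
      ?c * (pent_term j * (qpow (2 * (j * (j + 1))) * (rpoch (int l - j) * rpoch (int l + j + 1)))) - ?t j"
      using dvd_of_qpoch_rpoch[OF r re] by (simp only: dvd_mult)
  qed
  have "fps_nth (\<Sum>n\<le>l. fps_X ^ (2 * n * (n + 1)) * ?odd n * ?even n) l =
     fps_nth (\<Sum>n\<le>l. ?c * (qpow (2 * (int n * (int n + 1))) * rpoch (int l - int n) * pent_odd n)) l"
    using fps_nth_eq_of_dvd_diff[OF left] by simp
  also have "\<dots> = fps_nth (\<Sum>j = - int l - 1..int l. ?c * (pent_term j * (qpow (2 * (j * (j + 1))) * (rpoch (int l - j) * rpoch (int l + j + 1))))) l"
    unfolding sum_distrib_left[symmetric] bailey_sum ..
  also have "\<dots> = fps_nth (\<Sum>j = - int l - 1..int l. ?t j) l"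
    using fps_nth_eq_of_dvd_diff[OF right] by simp
  also have "\<dots> = (\<Sum>j = - int l - 1..int l. if 2 * int l = 7 * j^2 + 5 * j then if even j then 1 else - 1 else 0)"
    unfolding fps_sum_nth
  proof (rule sum.cong[OF refl])
    fix j
    have "l = nat (e j) \<longleftrightarrow> 2 * int l = 7 * j^2 + 5 * j"
      using e0[of j] e2[of j] by linarith
    thus "fps_nth (?t j) l = (if 2 * int l = 7 * j^2 + 5 * j then if even j then 1 else - 1 else 0)"
      by (auto simp: fps_X_power_nth)
  qed
  finally show ?thesis .
qed

section \<open>Exponents of the theta series\<close>

text \<open>The difference factors as \<open>(j-k)(7(j+k)+5)\<close>, and 7 does not divide
  5.\<close>

lemma theta_exponent_inj:
  assumes "7 * j^2 + 5 * j = 7 * k^2 + 5 * (k::int)"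
  shows "j = k"
proof (rule ccontr)
  assume "j \<noteq> k"
  have "(j - k) * (7 * (j + k) + 5) = 0"
    using assms by (simp add: algebra_simps power2_eq_square)
  with \<open>j \<noteq> k\<close> have "7 * (j + k) + 5 = 0" by simp
  thus False by presburger
qed

text \<open>By injectivity of the exponents at most one summand is nonzero, and it is 1 or
  -1.\<close>

lemma odd_theta_coeff_iff:
  "odd (\<Sum>j = - int l - 1..int l. if 2 * int l = 7 * j^2 + 5 * j then if even j then 1 else - 1 else (0::int))
     \<longleftrightarrow> (\<exists>j::int. 2 * int l = 7 * j^2 + 5 * j)"
    (is "odd (sum ?f ?I) \<longleftrightarrow> _")
proof (cases "\<exists>j::int. 2 * int l = 7 * j^2 + 5 * j")
  case True
  then obtain j :: int where j: "2 * int l = 7 * j^2 + 5 * j" by blast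
  have "j \<le> int l \<and> - int l - 1 \<le> j"
  proof -
    \<comment> \<open>This yields \<open>2l \<ge> 7|j| - 5|j| = 2|j|\<close>, so every solution lies
      in the summation range.\<close>
    have "\<bar>j\<bar> \<le> j^2"
    proof (cases "j = 0")
      case False
      hence "1 \<le> \<bar>j\<bar>" by linarith
      from self_le_power[OF this, of 2] show ?thesis by simp
    qed simp
    thus ?thesis using j by linarith
  qed
  moreover have "?f k = 0" if "k \<noteq> j" for k
    using theta_exponent_inj[of j k] j that by auto
  ultimately have "sum ?f ?I = sum ?f {j}"
    by (intro sum.mono_neutral_right) auto
  thus ?thesis using True j by simp
next
  case False
  hence "sum ?f ?I = 0" by (intro sum.neutral) auto
  thus ?thesis using False by simp
qed

section \<open>Parity of the partition counts\<close>

text \<open>Expanding the product over subsets, each \<open>A\<close> contributes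
  \<open>q^(\<Sum>A)\<close> up to sign, and signs vanish modulo 2.\<close>

lemma odd_fps_nth_prod_one_minus_iff:
  assumes "finite C"
  shows "odd (fps_nth (\<Prod>c\<in>C. 1 - fps_X ^ c :: int fps) k) \<longleftrightarrow> odd (card {A. A \<subseteq> C \<and> \<Sum>A = k})"
proof -
  have "(\<Prod>c\<in>C. 1 - fps_X ^ c :: int fps) = (\<Prod>c\<in>C. - (fps_X ^ c) + 1)" by simp
  also have "\<dots> = (\<Sum>A\<in>Pow C. \<Prod>c\<in>A. - (fps_X ^ c))"
    using prod_add[OF assms, of "\<lambda>c. - (fps_X ^ c)" "\<lambda>_. 1 :: int fps"] by simp
  also have "\<dots> = (\<Sum>A\<in>Pow C. (- 1) ^ card A * fps_X ^ (\<Sum>A))"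
    by (intro sum.cong refl) (simp add: prod_uminus power_sum)
  finally have "fps_nth (\<Prod>c\<in>C. 1 - fps_X ^ c :: int fps) k
      = (\<Sum>A\<in>Pow C. fps_nth ((- 1) ^ card A * fps_X ^ (\<Sum>A)) k)"
    by (simp add: fps_sum_nth)
  also have "\<dots> = (\<Sum>A\<in>Pow C. if \<Sum>A = k then (- 1) ^ card A else 0)"
  proof (intro sum.cong refl)
    fix A :: "nat set"
    have "(- 1 :: int fps) ^ card A = fps_const ((- 1) ^ card A)"
      by (metis fps_const_1_eq_1 fps_const_neg fps_const_power)
    thus "fps_nth ((- 1) ^ card A * fps_X ^ (\<Sum>A)) k = (if \<Sum>A = k then (- 1) ^ card A else (0::int))"
      by (simp add: fps_X_power_nth)
  qed
  finally have eq: "fps_nth (\<Prod>c\<in>C. 1 - fps_X ^ c :: int fps) k = \<dots>" .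
  have "{A \<in> Pow C. odd (if \<Sum>A = k then (- 1) ^ card A else (0::int))} = {A. A \<subseteq> C \<and> \<Sum>A = k}"
    by auto
  thus ?thesis unfolding eq using assms by (simp add: even_sum_iff)
qed

section \<open>Decomposition of the count by j\<close>

lemma member_le_of_is_partition: "is_partition p n \<Longrightarrow> k \<in># p \<Longrightarrow> k \<le> n"
  by (auto simp: is_partition_def dest!: multi_member_split)

lemma finite_partitions: "finite {p. is_partition p n}"
proof -
  have "{p. is_partition p n} \<subseteq> mset ` {xs. set xs \<subseteq> {..n} \<and> length xs \<le> n}"
  proof
    fix p assume "p \<in> {p. is_partition p n}"
    hence p: "is_partition p n" by simp
    obtain xs where xs: "mset xs = p" using ex_mset by blast
    have "set xs \<subseteq> {..n}" using member_le_of_is_partition[OF p] xs by auto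
    moreover have "size p \<le> sum_mset p" if "\<forall>k\<in>#p. 0 < k" for p :: "nat multiset"
      using that by (induction p) auto
    hence "length xs \<le> n"
      using p xs unfolding is_partition_def by (metis size_mset)
    ultimately show "p \<in> mset ` {xs. set xs \<subseteq> {..n} \<and> length xs \<le> n}" using xs by auto
  qed
  thus ?thesis by (rule finite_subset) (intro finite_imageI finite_lists_length_le, simp)
qed

text \<open>At \<open>j = 0\<close> no part is forced and the bound \<open>4j+2 = 2\<close> holds
  for every positive even part. Positivity of the parts settles multiplicity at 0, which
  \<open>cond_b\<close> leaves open.\<close>

lemma cond_a_iff_cond_b_0:
  assumes "is_partition p n"
  shows "cond_a p \<longleftrightarrow> cond_b 0 p"
proof -
  have pos: "0 \<notin># p"
    using assms by (auto simp: is_partition_def)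
  show ?thesis
  proof
    assume a: "cond_a p"
    have "k \<ge> 2" if "even k" "k > 0" for k :: nat using that by presburger
    with a show "cond_b 0 p" by (auto simp: cond_a_def cond_b_def)
  next
    assume b: "cond_b 0 p"
    have "count p k \<le> 1" if "even k" for k
    proof (cases "k \<in># p")
      case True
      hence "k > 0" using pos by (cases "k = 0") auto
      thus ?thesis using True that b by (auto simp: cond_b_def)
    qed (simp add: not_in_iff)
    moreover have "k = 1" if "k \<in># p" "odd k" for k
    proof -
      have "k \<le> 1" using that b by (auto simp: cond_b_def)
      thus ?thesis using that(2) by presburger
    qed
    ultimately show "cond_a p" by (auto simp: cond_a_def)
  qed
qed

text \<open>If \<open>i < j\<close>, the part \<open>2(i+1)\<close> would occur twice by the
  condition for \<open>j\<close> but at most once by that for \<open>i\<close>.\<close>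

lemma cond_b_unique:
  assumes "cond_b i p" "cond_b j p"
  shows "i = j"
proof -
  have False if "cond_b i p" "cond_b j p" "i < j" for i j
  proof -
    have "\<forall>m\<in>{1..j}. count p (2 * m) = 2" using that(2) unfolding cond_b_def by blast
    hence "count p (2 * (i + 1)) = 2" by (rule bspec) (use that(3) in simp)
    moreover from this have "2 * (i + 1) \<in># p" by (intro count_inI) simp
    moreover have "count p k \<le> 1" if "k \<in># p" "even k" "k > 2 * i" for k
      using \<open>cond_b i p\<close> that by (simp add: cond_b_def)
    ultimately show False by fastforce
  qed
  thus ?thesis using assms by (meson linorder_neqE_nat)
qed

definition typed_partitions :: "nat \<Rightarrow> nat \<Rightarrow> nat multiset set" where
  "typed_partitions n j = {p. is_partition p n \<and> cond_b j p}"

lemma finite_typed_partitions: "finite (typed_partitions n j)"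
  using finite_partitions[of n] by (rule rev_finite_subset) (auto simp: typed_partitions_def)

lemma typed_partitions_empty:
  assumes "j > n" shows "typed_partitions n j = {}"
proof -
  have False if "is_partition p n" "cond_b j p" for p
  proof -
    have "count p (2 * j) = 2" using that(2) assms by (simp add: cond_b_def)
    hence "2 * j \<in># p" by (intro count_inI) simp
    thus False using member_le_of_is_partition[OF that(1)] assms by fastforce
  qed
  thus ?thesis by (auto simp: typed_partitions_def)
qed

lemma c6_eq_sum: "c6 n = (\<Sum>j\<le>n. card (typed_partitions n j))"
proof -
  have "{p. is_partition p n \<and> (cond_a p \<or> (\<exists>j\<ge>1. cond_b j p))} = (\<Union>j. typed_partitions n j)"
  proof -
    have "(cond_a p \<or> (\<exists>j\<ge>1. cond_b j p)) \<longleftrightarrow> (\<exists>j. cond_b j p)" if "is_partition p n" for p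
      unfolding cond_a_iff_cond_b_0[OF that] by (metis One_nat_def Suc_leI gr0I)
    thus ?thesis by (auto simp: typed_partitions_def)
  qed
  also have "\<dots> = (\<Union>j\<in>{..n}. typed_partitions n j)"
    using typed_partitions_empty[of n] by (force simp flip: not_le)
  also have "card \<dots> = (\<Sum>j\<le>n. card (typed_partitions n j))"
    by (intro card_UN_disjoint)
      (auto simp: finite_typed_partitions, auto simp: typed_partitions_def dest: cond_b_unique)
  finally show ?thesis by (simp add: c6_def)
qed

section \<open>Cancellation in pairs\<close>

text \<open>The condition leaves the multiplicity of \<open>2j+1\<close> free and only bounds that
  of \<open>4j+2\<close> by 1, so trading between these two parts preserves it.\<close>

lemma cond_b_cong:
  assumes "cond_b j p"
    and "\<And>k. k \<noteq> 2 * j + 1 \<Longrightarrow> k \<noteq> 4 * j + 2 \<Longrightarrow> count p' k = count p k"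
    and "count p' (4 * j + 2) \<le> 1"
  shows "cond_b j p'"
proof -
  have mem: "k \<in># p' \<longleftrightarrow> k \<in># p" if "k \<noteq> 2 * j + 1" "k \<noteq> 4 * j + 2" for k
    using assms(2)[OF that] by (metis count_eq_zero_iff)
  moreover have "count p' (2 * i) = 2" if "i \<in> {1..j}" for i
  proof -
    have "2 * i \<noteq> 2 * j + 1" "2 * i \<noteq> 4 * j + 2" using that by (presburger, auto)
    thus ?thesis using assms(1,2) that by (simp add: cond_b_def)
  qed
  moreover have "k \<ge> 4 * j + 2 \<and> count p' k \<le> 1" if "k \<in># p'" "even k" "k > 2 * j" for k
    using that assms mem[of k] unfolding cond_b_def
    by (cases "k = 4 * j + 2") auto
  moreover have "k \<le> 2 * j + 1" if "k \<in># p'" "odd k" for k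
  proof (cases "k = 2 * j + 1")
    case False
    moreover have "k \<noteq> 4 * j + 2" using \<open>odd k\<close> by auto
    ultimately have "k \<in># p" using \<open>k \<in># p'\<close> mem by blast
    thus ?thesis using \<open>odd k\<close> assms(1) unfolding cond_b_def by blast
  qed simp
  moreover have "count p' k \<le> 1" if "odd k" "k + 1 \<le> 2 * j" for k
    using that assms(1) assms(2)[of k] unfolding cond_b_def by auto
  ultimately show ?thesis unfolding cond_b_def by blast
qed

lemma count_le_1_of_cond_b:
  assumes "cond_b j p" shows "count p (4 * j + 2) \<le> 1"
proof (cases "4 * j + 2 \<in># p")
  case True
  thus ?thesis using assms unfolding cond_b_def by auto
qed (simp add: not_in_iff)

definition reduced_partitions :: "nat \<Rightarrow> nat \<Rightarrow> nat multiset set" where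
  "reduced_partitions n j = {p \<in> typed_partitions n j. 4 * j + 2 \<notin># p \<and> count p (2 * j + 1) \<le> 1}"

text \<open>The trade matches partitions containing \<open>4j+2\<close> (\<open>S\<close>) with
  those lacking it but having two copies of \<open>2j+1\<close> (\<open>T\<close>). The two classes
  together contribute an even number.\<close>

lemma even_card_typed_iff_reduced:
  "even (card (typed_partitions n j)) \<longleftrightarrow> even (card (reduced_partitions n j))"
proof -
  define S where "S = {p \<in> typed_partitions n j. 4 * j + 2 \<in># p}"
  define T where "T = {p \<in> typed_partitions n j. 4 * j + 2 \<notin># p \<and> count p (2 * j + 1) \<ge> 2}"
  let ?two = "{#2 * j + 1, 2 * j + 1#}"
  have "bij_betw (\<lambda>p. p - {#4 * j + 2#} + ?two) S T"
  proof (rule bij_betw_byWitness[where f' = "\<lambda>p. p - ?two + {#4 * j + 2#}"])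
    show "\<forall>p\<in>S. p - {#4 * j + 2#} + ?two - ?two + {#4 * j + 2#} = p"
      by (auto simp: S_def)
    have sub: "?two \<subseteq># p" if "count p (2 * j + 1) \<ge> 2" for p
      using that by (auto simp: subseteq_mset_def)
    show "\<forall>p\<in>T. p - ?two + {#4 * j + 2#} - {#4 * j + 2#} + ?two = p"
    proof
      fix p assume "p \<in> T"
      hence "?two \<subseteq># p" using sub by (simp add: T_def)
      thus "p - ?two + {#4 * j + 2#} - {#4 * j + 2#} + ?two = p"
        by (simp only: add_diff_cancel_right' subset_mset.diff_add)
    qed
    show "(\<lambda>p. p - {#4 * j + 2#} + ?two) ` S \<subseteq> T"
    proof (rule image_subsetI)
      fix p assume "p \<in> S"
      hence p: "is_partition p n" "cond_b j p" "4 * j + 2 \<in># p"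
        by (auto simp: S_def typed_partitions_def)
      let ?p = "p - {#4 * j + 2#} + ?two"
      \<comment> \<open>As \<open>4j+2\<close> occurs at most once, removing one copy makes it
        absent, as membership in \<open>T\<close> demands.\<close>
      have c: "count ?p (4 * j + 2) = 0" "count ?p (2 * j + 1) \<ge> 2"
        using count_le_1_of_cond_b[OF p(2)] by auto
      have "sum_mset ?p = n"
        using p(1) multi_member_split[OF p(3)] by (auto simp: is_partition_def)
      hence "is_partition ?p n"
        using p(1) unfolding is_partition_def by (auto dest: in_diffD)
      moreover have "cond_b j ?p"
        by (rule cond_b_cong[OF p(2)]) (use c in auto)
      ultimately show "?p \<in> T"
        using c by (auto simp: T_def typed_partitions_def not_in_iff)
    qed
    show "(\<lambda>p. p - ?two + {#4 * j + 2#}) ` T \<subseteq> S"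
    proof (rule image_subsetI)
      fix p assume "p \<in> T"
      hence p: "is_partition p n" "cond_b j p" "4 * j + 2 \<notin># p" "?two \<subseteq># p"
        using sub by (auto simp: T_def typed_partitions_def)
      let ?p = "p - ?two + {#4 * j + 2#}"
      have c: "count ?p (4 * j + 2) = 1" using p(3) by (simp add: not_in_iff)
      have "sum_mset p = sum_mset (p - ?two) + sum_mset ?two"
        using p(4) by (metis subset_mset.diff_add sum_mset.union)
      hence "sum_mset ?p = sum_mset p" by simp
      hence "is_partition ?p n"
        using p(1) unfolding is_partition_def by (auto dest: in_diffD)
      moreover have "cond_b j ?p"
        by (rule cond_b_cong[OF p(2)]) (use c in auto)
      ultimately show "?p \<in> S"
        by (auto simp: S_def typed_partitions_def)
    qed
  qed
  hence "card S = card T" by (rule bij_betw_same_card)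
  moreover have "card (typed_partitions n j) = card S + (card T + card (reduced_partitions n j))"
  proof -
    have fin: "finite S" "finite T" "finite (reduced_partitions n j)"
      using finite_typed_partitions[of n j] by (auto simp: S_def T_def reduced_partitions_def)
    have "typed_partitions n j = S \<union> (T \<union> reduced_partitions n j)"
      by (auto simp: S_def T_def reduced_partitions_def)
    moreover have "card \<dots> = card S + card (T \<union> reduced_partitions n j)"
      using fin by (intro card_Un_disjoint) (auto simp: S_def T_def reduced_partitions_def)
    moreover have "card (T \<union> reduced_partitions n j) = card T + card (reduced_partitions n j)"
      using fin by (intro card_Un_disjoint) (auto simp: T_def reduced_partitions_def)
    ultimately show ?thesis by simp
  qed
  ultimately have "card (typed_partitions n j) = 2 * card T + card (reduced_partitions n j)"
    by linarith
  thus ?thesis by simp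
qed

section \<open>Reduced partitions as subsets of free parts\<close>

text \<open>The candidates for parts beyond the forced ones. The cutoff \<open>4n+2\<close> exceeds
  \<open>n\<close>, so it excludes no part of a partition of \<open>n\<close>, and it agrees with
  the truncated product of level \<open>n\<close>.\<close>

definition free_parts :: "nat \<Rightarrow> nat \<Rightarrow> nat set" where
  "free_parts n j = (\<lambda>i. 2 * i + 1) ` {..<Suc j} \<union> (\<lambda>i. 2 * i) ` {2 * j + 2..2 * n + 1}"

definition doubled_parts :: "nat \<Rightarrow> nat multiset" where
  "doubled_parts j = mset_set ((\<lambda>i. 2 * i) ` {1..j}) + mset_set ((\<lambda>i. 2 * i) ` {1..j})"

lemma sum_mset_mset_set_eq_sum: "sum_mset (mset_set A) = \<Sum>A"
  by (simp add: sum_unfold_sum_mset)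

lemma count_doubled_parts: "count (doubled_parts j) k = (if even k \<and> 0 < k \<and> k \<le> 2 * j then 2 else 0)"
proof -
  have "k \<in> (\<lambda>i. 2 * i) ` {1..j} \<longleftrightarrow> even k \<and> 0 < k \<and> k \<le> 2 * j"
    by (auto elim!: evenE)
  thus ?thesis by (simp add: doubled_parts_def count_mset_set')
qed

lemma sum_doubled_parts: "sum_mset (doubled_parts j) = 2 * j * (j + 1)"
proof -
  have "sum_mset (doubled_parts j) = 2 * (\<Sum>i=1..j. 2 * i)"
    unfolding doubled_parts_def
    by (simp add: sum_mset_mset_set_eq_sum sum.reindex inj_on_def)
  also have "(\<Sum>i=1..j. 2 * i) = j * (j + 1)"
    by (induction j) auto
  finally show ?thesis by simp
qed

lemma mem_free_parts_iff:
  "x \<in> free_parts n j \<longleftrightarrow> (odd x \<and> x \<le> 2 * j + 1) \<or> (even x \<and> 4 * j + 4 \<le> x \<and> x \<le> 4 * n + 2)"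
proof -
  have "x \<in> (\<lambda>i. 2 * i + 1) ` {..<Suc j} \<longleftrightarrow> odd x \<and> x \<le> 2 * j + 1"
    by (auto elim!: oddE)
  moreover have "x \<in> (\<lambda>i. 2 * i) ` {2 * j + 2..2 * n + 1} \<longleftrightarrow> even x \<and> 4 * j + 4 \<le> x \<and> x \<le> 4 * n + 2"
    by (auto elim!: evenE)
  ultimately show ?thesis unfolding free_parts_def Un_iff by simp
qed

text \<open>Besides the forced pairs, of total weight \<open>2j(j+1)\<close>, the parts of a reduced
  partition are distinct and form a set. That set is recovered as the parts that are odd or exceed
  \<open>2j\<close>.\<close>

lemma card_reduced_partitions:
  "card (reduced_partitions n j) = card {A. A \<subseteq> free_parts n j \<and> \<Sum>A + 2 * j * (j + 1) = n}"
proof -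
  have fin: "finite A" if "A \<subseteq> free_parts n j" for A
    using that by (rule finite_subset) (simp add: free_parts_def)
  have cnt: "count (mset_set A + doubled_parts j) k =
      (if k \<in> A then 1 else if even k \<and> 0 < k \<and> k \<le> 2 * j then 2 else 0)"
    if "A \<subseteq> free_parts n j" for A k
    using that fin[OF that] by (auto simp: count_doubled_parts count_mset_set' mem_free_parts_iff)
  have "bij_betw (\<lambda>A. mset_set A + doubled_parts j)
     {A. A \<subseteq> free_parts n j \<and> \<Sum>A + 2 * j * (j + 1) = n} (reduced_partitions n j)"
  proof (rule bij_betw_byWitness[where f' = "\<lambda>p. {x \<in> set_mset p. odd x \<or> 2 * j < x}"])
    have mem: "k \<in># mset_set A + doubled_parts j \<longleftrightarrow> k \<in> A \<or> even k \<and> 0 < k \<and> k \<le> 2 * j"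
      if "A \<subseteq> free_parts n j" for A k
      using cnt[OF that, of k] by (simp only: count_greater_zero_iff[symmetric]) auto
    show "\<forall>A\<in>{A. A \<subseteq> free_parts n j \<and> \<Sum>A + 2 * j * (j + 1) = n}.
       {x \<in> set_mset (mset_set A + doubled_parts j). odd x \<or> 2 * j < x} = A"
    proof
      fix A assume "A \<in> {A. A \<subseteq> free_parts n j \<and> \<Sum>A + 2 * j * (j + 1) = n}"
      hence A: "A \<subseteq> free_parts n j" by simp
      have "odd x \<or> 2 * j < x" if "x \<in> A" for x
        using that A by (auto simp: mem_free_parts_iff)
      thus "{x \<in> set_mset (mset_set A + doubled_parts j). odd x \<or> 2 * j < x} = A"
        unfolding mem[OF A] by auto
    qed
    show "(\<lambda>A. mset_set A + doubled_parts j) ` {A. A \<subseteq> free_parts n j \<and> \<Sum>A + 2 * j * (j + 1) = n}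
       \<subseteq> reduced_partitions n j"
    proof (rule image_subsetI)
      fix A assume "A \<in> {A. A \<subseteq> free_parts n j \<and> \<Sum>A + 2 * j * (j + 1) = n}"
      hence A: "A \<subseteq> free_parts n j" "\<Sum>A + 2 * j * (j + 1) = n" by auto
      let ?p = "mset_set A + doubled_parts j"
      have A': "(odd x \<and> x \<le> 2 * j + 1) \<or> (even x \<and> 4 * j + 4 \<le> x)" if "x \<in> A" for x
        using that A(1) by (auto simp: mem_free_parts_iff)
      have "sum_mset ?p = n"
        using A(2) by (simp add: sum_doubled_parts sum_mset_mset_set_eq_sum)
      moreover have "0 < k" if "k \<in># ?p" for k
        using that A'[of k] unfolding mem[OF A(1)] by (cases "k = 0") auto
      moreover have "cond_b j ?p"
      proof -
        have "set_mset ?p = A \<union> {k. even k \<and> 0 < k \<and> k \<le> 2 * j}"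
          using mem[OF A(1)] by blast
        thus ?thesis
          unfolding cond_b_def cnt[OF A(1)] by (auto dest: A')
      qed
      moreover have "4 * j + 2 \<notin># ?p" "count ?p (2 * j + 1) \<le> 1"
        unfolding cnt[OF A(1)] mem[OF A(1)] by (auto dest: A')
      ultimately show "?p \<in> reduced_partitions n j"
        by (auto simp: reduced_partitions_def typed_partitions_def is_partition_def)
    qed
    have inv: "{x \<in> set_mset p. odd x \<or> 2 * j < x} \<subseteq> free_parts n j \<and>
        mset_set {x \<in> set_mset p. odd x \<or> 2 * j < x} + doubled_parts j = p"
      if "p \<in> reduced_partitions n j" for p
    proof -
      let ?A = "{x \<in> set_mset p. odd x \<or> 2 * j < x}"
      have p: "is_partition p n" "cond_b j p" "4 * j + 2 \<notin># p" "count p (2 * j + 1) \<le> 1"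
        using that by (auto simp: reduced_partitions_def typed_partitions_def)
      have sub: "?A \<subseteq> free_parts n j"
      proof
        fix x assume x: "x \<in> ?A"
        have "x \<le> n" using x member_le_of_is_partition[OF p(1)] by auto
        moreover have "x \<le> 2 * j + 1" if "odd x" using that x p(2) by (auto simp: cond_b_def)
        moreover have "4 * j + 4 \<le> x" if "even x"
        proof -
          \<comment> \<open>Condition (b) only gives \<open>4j+2\<close>; reducedness excludes
            equality, and parity then lifts the bound to \<open>4j+4\<close>.\<close>
          have "4 * j + 2 \<le> x" using that x p(2) by (auto simp: cond_b_def)
          moreover have "x \<noteq> 4 * j + 2" using x p(3) by auto
          ultimately show ?thesis using that by presburger
        qed
        ultimately show "x \<in> free_parts n j" by (auto simp: mem_free_parts_iff)
      qed
      have "count (mset_set ?A + doubled_parts j) k = count p k" for k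
      proof -
        \<comment> \<open>Forced parts, the value 0, free parts that occur, and values that do not
          occur. Zero needs its own case because it is even without being forced.\<close>
        consider "even k" "0 < k" "k \<le> 2 * j" | "k = 0" | "k \<in> ?A" | "k \<notin># p" "odd k \<or> 2 * j < k"
          by fastforce
        thus ?thesis
        proof cases
          case 1
          then obtain i where "k = 2 * i" by (auto elim: evenE)
          thus ?thesis using 1 p(2) unfolding cnt[OF sub] by (auto simp: cond_b_def)
        next
          case 2
          have "0 \<notin># p" using p(1) by (auto simp: is_partition_def)
          thus ?thesis using 2 unfolding cnt[OF sub] by (simp add: not_in_iff)
        next
          case 3
          have "count p k \<le> 1"
          proof (cases "even k")
            case True
            thus ?thesis using 3 p(2) by (auto simp: cond_b_def)
          next
            case False
            hence "k \<le> 2 * j + 1" using 3 p(2) by (auto simp: cond_b_def)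
            hence "k = 2 * j + 1 \<or> k + 1 \<le> 2 * j" using False by presburger
            thus ?thesis using False p(2,4) by (auto simp: cond_b_def)
          qed
          moreover have "count p k > 0" using 3 by simp
          ultimately have "count p k = 1" by linarith
          thus ?thesis using 3 unfolding cnt[OF sub] by simp
        next
          case 4
          thus ?thesis unfolding cnt[OF sub] by (auto simp: not_in_iff)
        qed
      qed
      thus ?thesis using sub by (simp only: multiset_eq_iff) blast
    qed
    show "\<forall>p\<in>reduced_partitions n j. mset_set {x \<in> set_mset p. odd x \<or> 2 * j < x} + doubled_parts j = p"
      using inv by blast
    show "(\<lambda>p. {x \<in> set_mset p. odd x \<or> 2 * j < x}) ` reduced_partitions n j
      \<subseteq> {A. A \<subseteq> free_parts n j \<and> \<Sum>A + 2 * j * (j + 1) = n}"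
    proof (rule image_subsetI)
      fix p assume p: "p \<in> reduced_partitions n j"
      let ?A = "{x \<in> set_mset p. odd x \<or> 2 * j < x}"
      have "sum_mset (mset_set ?A + doubled_parts j) = n"
        using inv[OF p] p by (simp add: reduced_partitions_def typed_partitions_def is_partition_def)
      hence "\<Sum>?A + 2 * j * (j + 1) = n"
        by (simp add: sum_doubled_parts sum_mset_mset_set_eq_sum)
      thus "?A \<in> {A. A \<subseteq> free_parts n j \<and> \<Sum>A + 2 * j * (j + 1) = n}"
        using inv[OF p] by blast
    qed
  qed
  thus ?thesis by (rule bij_betw_same_card[symmetric])
qed

text \<open>The forced pairs give the power of \<open>q\<close>, and subsets of the free parts give
  the product, modulo 2.\<close>

lemma odd_card_typed_iff:
  "odd (card (typed_partitions n j)) \<longleftrightarrow>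
   odd (fps_nth (fps_X ^ (2 * j * (j + 1)) * (\<Prod>i<Suc j. 1 - fps_X ^ (2 * i + 1))
       * (\<Prod>i=2 * j + 2..2 * n + 1. 1 - fps_X ^ (2 * i)) :: int fps) n)"
proof -
  let ?m = "2 * j * (j + 1)"
  let ?P = "\<Prod>c\<in>free_parts n j. 1 - fps_X ^ c :: int fps"
  have "(\<lambda>i. 2 * i + 1) ` {..<Suc j} \<inter> (\<lambda>i. 2 * i) ` {2 * j + 2..2 * n + 1} = ({} :: nat set)"
    by (auto dest: arg_cong[where f = even])
  hence "?P = (\<Prod>c\<in>(\<lambda>i. 2 * i + 1) ` {..<Suc j}. 1 - fps_X ^ c) * (\<Prod>c\<in>(\<lambda>i. 2 * i) ` {2 * j + 2..2 * n + 1}. 1 - fps_X ^ c)"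
    unfolding free_parts_def by (intro prod.union_disjoint) auto
  also have "\<dots> = (\<Prod>i<Suc j. 1 - fps_X ^ (2 * i + 1)) * (\<Prod>i=2 * j + 2..2 * n + 1. 1 - fps_X ^ (2 * i))"
    by (intro arg_cong2[where f = "(*)"]) (subst prod.reindex; simp add: inj_on_def o_def)+
  finally have P: "fps_X ^ ?m * (\<Prod>i<Suc j. 1 - fps_X ^ (2 * i + 1))
       * (\<Prod>i=2 * j + 2..2 * n + 1. 1 - fps_X ^ (2 * i)) = fps_X ^ ?m * ?P"
    by (simp only: mult.assoc)
  have fin: "finite (free_parts n j)" by (simp add: free_parts_def)
  show ?thesis
  proof (cases "n < ?m")
    case True
    hence "{A. A \<subseteq> free_parts n j \<and> \<Sum>A + ?m = n} = {}" by auto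
    moreover have "fps_nth (fps_X ^ ?m * ?P) n = 0"
      using True by (simp only: fps_X_power_mult_nth if_True)
    ultimately show ?thesis
      unfolding P even_card_typed_iff_reduced card_reduced_partitions by (simp only: card.empty even_zero)
  next
    case False
    hence "\<Sum>A + ?m = n \<longleftrightarrow> \<Sum>A = n - ?m" for A :: "nat set" by linarith
    moreover have "fps_nth (fps_X ^ ?m * ?P) n = fps_nth ?P (n - ?m)"
      using False by (simp only: fps_X_power_mult_nth if_False)
    ultimately show ?thesis
      unfolding P even_card_typed_iff_reduced card_reduced_partitions
      by (simp only: odd_fps_nth_prod_one_minus_iff[OF fin])
  qed
qed

theorem theorem7:
  fixes n :: nat
  shows "odd (c6 n) \<longleftrightarrow> (\<exists>j::int. 2 * int n = 7*j^2 + 5*j)"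
proof -
  let ?g = "\<lambda>j. fps_X ^ (2 * j * (j + 1)) * (\<Prod>i<Suc j. 1 - fps_X ^ (2 * i + 1))
       * (\<Prod>i=2 * j + 2..2 * n + 1. 1 - fps_X ^ (2 * i)) :: int fps"
  \<comment> \<open>The parity of a sum depends only on which summands are odd, so each cardinality
    may be replaced by a coefficient of the same parity.\<close>
  have "odd (c6 n) \<longleftrightarrow> odd (\<Sum>j\<le>n. fps_nth (?g j) n)"
    unfolding c6_eq_sum even_sum_iff[OF finite_atMost] odd_card_typed_iff ..
  also have "\<dots> \<longleftrightarrow> (\<exists>j::int. 2 * int n = 7*j^2 + 5*j)"
    unfolding fps_sum_nth[symmetric] rogers_selberg_truncated odd_theta_coeff_iff ..
  finally show ?thesis .
qed

end
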